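(* Let $\mathcal{M}$ be a weakly bounded moment functional. (1) If a function $f$ is analytic on a domain $G\subseteq\mathbb{C}$ and $u\in G$, then there is a disc $D\subseteq G$ centred at $u$ on which the chromatic expansion $$\sum_{k=0}^{\infty}(-1)^k\,\mathcal{K}^k[f](u)\,\mathcal{K}^k[\mathbf{m}](z-u)$$ of $f$ centred at $u$ converges uniformly to $f(z)$. (2) In particular, if $f$ is entire and $u\in\mathbb{C}$, then the chromatic expansion of $f$ centred at $u$ converges to $f(z)$ for every $z\in\mathbb{C}$, and the convergence is uniform on every disc around $u$ of finite radius.
   Context: $\mathcal{M}$ is a linear functional on polynomials with real coefficients in $\omega$, with moments $\mu_n=\mathcal{M}(\omega^n)$; it is positive definite (all Hankel determinants $\det(\mu_{i+j})_{i,j=0}^n$ are $>0$) and normalised ($\mu_0=1$). $\alpha$ is a corresponding moment distribution function: non-decreasing, bounded, with $\mu_n=\int_{-\infty}^{\infty}\omega^n\,d\alpha(\omega)$ for all $n$. $(p_n)_{n\in\mathbb{N}}$ are the orthonormal polynomials of $\mathcal{M}$: $\deg p_n=n$, $\mathcal{M}(p_np_m)=\delta(m-n)$, $p_0\equiv1$, satisfying, for $n\ge0$ and with $p_{-1}\equiv0$, $\gamma_{-1}=1$, the recurrence $p_{n+1}(\omega)=\frac{\omega+\beta_n}{\gamma_n}p_n(\omega)-\frac{\gamma_{n-1}}{\gamma_n}p_{n-1}(\omega)$ with reals $\gamma_n>0$ and $\beta_n$. $\mathcal{M}$ is weakly bounded if there exist $M\ge1$ and $0\le p<1$ such that for all $n\ge0$: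 $\frac1M(n+1)^p\le\gamma_n\le M(n+1)^p$ and $\frac{|\beta_n|}{\gamma_n}\le M$. Chromatic derivatives: $\mathcal{K}^n=\mathrm{i}^np_n(-\mathrm{i}\,D)$ with $D=d/dz$ (i.e. $\omega^k$ is replaced by $(-\mathrm{i})^kD^k$). $\mathbf{m}(z)=\int_{-\infty}^{\infty}e^{\mathrm{i}\omega z}\,d\alpha(\omega)$, which is an entire function when $\mathcal{M}$ is weakly bounded. *)

theory Defs
  imports "HOL-Complex_Analysis.Complex_Analysis" "Jordan_Normal_Form.Determinant"
begin

definition moment :: "(real poly \<Rightarrow> real) \<Rightarrow> nat \<Rightarrow> real" where
  "moment \<M> n = \<M> (Polynomial.monom 1 n)"

text \<open>The Hankel matrices need a dimension that varies with \<open>n\<close>, hence \<open>det\<close> and \<open>mat\<close> from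
  Jordan_Normal_Form rather than their namesakes in HOL-Analysis.\<close>

definition moment_functional :: "(real poly \<Rightarrow> real) \<Rightarrow> bool" where
  "moment_functional \<M> \<longleftrightarrow>
     (\<forall>a b. \<M> (a + b) = \<M> a + \<M> b) \<and>
     (\<forall>c a. \<M> (Polynomial.smult c a) = c * \<M> a) \<and>
     (\<forall>n. Determinant.det
            (Matrix.mat (Suc n) (Suc n) (\<lambda>(i, j). moment \<M> (i + j))) > 0) \<and>
     moment \<M> 0 = 1"

text \<open>The measure \<open>d\<alpha>\<close> of a non-decreasing function that need not be right-continuous. It only
  depends on the one-sided limits of \<open>\<alpha>\<close>, but \<^const>\<open>interval_measure\<close> is meaningful only for
  right-continuous functions, so \<open>\<alpha>\<close> is replaced by its right limits.\<close>

definition stieltjes_measure :: "(real \<Rightarrow> real) \<Rightarrow> real measure" where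
  "stieltjes_measure \<alpha> = interval_measure (\<lambda>x. Lim (at_right x) \<alpha>)"

definition moment_distribution :: "(real poly \<Rightarrow> real) \<Rightarrow> (real \<Rightarrow> real) \<Rightarrow> bool" where
  "moment_distribution \<M> \<alpha> \<longleftrightarrow>
     mono \<alpha> \<and> bounded (range \<alpha>) \<and>
     (\<forall>n. integrable (stieltjes_measure \<alpha>) (\<lambda>\<omega>. \<omega> ^ n) \<and>
          moment \<M> n = (LINT \<omega>|stieltjes_measure \<alpha>. \<omega> ^ n))"

text \<open>The \<open>if\<close> in the recurrence encodes \<open>p\<^sub>-\<^sub>1 = 0\<close>.\<close>

definition orthonormal_polys ::
    "(real poly \<Rightarrow> real) \<Rightarrow> (nat \<Rightarrow> real poly) \<Rightarrow> (nat \<Rightarrow> real) \<Rightarrow> (nat \<Rightarrow> real) \<Rightarrow> bool" where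
  "orthonormal_polys \<M> P \<gamma> \<beta> \<longleftrightarrow>
     (\<forall>n. Polynomial.degree (P n) = n) \<and>
     (\<forall>m n. \<M> (P n * P m) = (if m = n then 1 else 0)) \<and>
     P 0 = 1 \<and>
     (\<forall>n. \<gamma> n > 0) \<and>
     (\<forall>n. P (Suc n) = Polynomial.smult (1 / \<gamma> n) ([:\<beta> n, 1:] * P n)
                       - (if n = 0 then 0 else Polynomial.smult (\<gamma> (n - 1) / \<gamma> n) (P (n - 1))))"

text \<open>Stated on the recurrence coefficients, which a positive definite functional determines
  uniquely, so this is a property of the functional.\<close>

definition weakly_bounded :: "(nat \<Rightarrow> real) \<Rightarrow> (nat \<Rightarrow> real) \<Rightarrow> bool" where
  "weakly_bounded \<gamma> \<beta> \<longleftrightarrow>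
     (\<exists>M p. M \<ge> 1 \<and> 0 \<le> p \<and> p < 1 \<and>
        (\<forall>n. (1 / M) * (real n + 1) powr p \<le> \<gamma> n \<and>
             \<gamma> n \<le> M * (real n + 1) powr p \<and>
             \<bar>\<beta> n\<bar> / \<gamma> n \<le> M))"

text \<open>\<open>\<K>\<^sup>n = \<i>\<^sup>n p\<^sub>n(-\<i> D)\<close>.\<close>

definition chromatic_deriv ::
    "(nat \<Rightarrow> real poly) \<Rightarrow> nat \<Rightarrow> (complex \<Rightarrow> complex) \<Rightarrow> complex \<Rightarrow> complex" where
  "chromatic_deriv P n f z =
     \<i> ^ n * (\<Sum>k\<le>Polynomial.degree (P n). of_real (Polynomial.coeff (P n) k) * (- \<i>) ^ k * (deriv ^^ k) f z)"

definition moment_transform :: "(real \<Rightarrow> real) \<Rightarrow> complex \<Rightarrow> complex" where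
  "moment_transform \<alpha> z = (LINT \<omega>|stieltjes_measure \<alpha>. exp (\<i> * of_real \<omega> * z))"

definition chromatic_term ::
    "(nat \<Rightarrow> real poly) \<Rightarrow> (real \<Rightarrow> real) \<Rightarrow> (complex \<Rightarrow> complex) \<Rightarrow> complex \<Rightarrow> nat \<Rightarrow> complex \<Rightarrow> complex"
  where
  "chromatic_term P \<alpha> f u k z =
     (- 1) ^ k * chromatic_deriv P k f u * chromatic_deriv P k (moment_transform \<alpha>) (z - u)"

end

theory Submission
  imports Defs "HOL-Real_Asymp.Real_Asymp"
begin

text \<open>Write \<open>b n k = \<M> (\<omega>\<^sup>n p\<^sub>k)\<close>, \<open>c k j\<close> for the coefficient of \<open>\<omega>\<^sup>j\<close> in \<open>p\<^sub>k\<close>, and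
  \<open>w = z - u\<close>. Both factors of a chromatic term are then explicit: \<open>\<K>\<^sup>k[f](u)\<close> is a combination of the
  derivatives of \<open>f\<close> at \<open>u\<close> with weights \<open>c k j\<close>, and expanding the exponential under the integral gives
  \<open>\<K>\<^sup>k[m](w) = \<i>\<^sup>k (\<Sum>n. b n k (\<i>w)\<^sup>n / n!)\<close>. Since \<open>\<omega>\<^sup>n = (\<Sum>k\<le>n. b n k p\<^sub>k)\<close>, the triangular
  matrices \<open>b\<close> and \<open>c\<close> are inverse to each other. Hence, once the double sum over \<open>k\<close> and \<open>n\<close> may be
  interchanged, the chromatic expansion collapses to the Taylor series of \<open>f\<close> at \<open>u\<close>, which is why
  it represents \<open>f\<close>.

  Absolute convergence comes from the three-term recurrence. With exponent \<open>p < 1\<close> in the weak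
  boundedness condition, a multiplication by \<open>\<omega>\<close> at level \<open>n\<close> costs a factor of order \<open>n\<^sup>p\<close>, and so
  \<open>\<bar>b n k\<bar> \<le> C\<^sup>n (n!)\<^sup>p\<close> (\<open>abs_mixed_moment_le\<close>). Conversely each power of \<open>\<omega>\<close> in \<open>p\<^sub>k\<close> is paid
  for by a division by some \<open>\<gamma>\<close>, and so \<open>\<bar>c k j\<bar> \<le> C\<^sup>k / (j!)\<^sup>p\<close> (\<open>abs_coeff_P_le\<close>). If \<open>f\<close>
  is holomorphic on a disc of radius \<open>R\<close>, then Cauchy's estimates bound the \<open>j\<close>-th derivative at \<open>u\<close>
  by \<open>A j! / R\<^sup>j\<close>. Put \<open>q = 1 - p > 0\<close> and \<open>X = C\<^sup>2 \<bar>w\<bar>\<close>. Because \<open>j! (k - j)! \<le> k!\<close>, the \<open>k\<close>-th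
  term is at most a constant times
  \<open>(\<Sum>j\<le>k. (X / R)\<^sup>j X\<^bsup>k - j\<^esup> / ((k - j)!)\<^sup>q)\<close>. This is the Cauchy product of a geometric series and an
  everywhere convergent series, so it is summable whenever \<open>X < R\<close>.

  The disc of convergence thus has radius at least a fixed fraction of \<open>R\<close>
  (\<open>chromatic_expansion_near_centre\<close> uses \<open>R / (2 C\<^sup>2)\<close>). The fraction does not depend on \<open>f\<close> or \<open>R\<close>,
  so a small \<open>R\<close> yields the local statement, and letting \<open>R\<close> grow yields the statement for entire
  functions.\<close>

section \<open>Series with factorial denominators\<close>

lemma summable_power_over_fact_powr:
  fixes x q :: real
  assumes "q > 0"
  shows "summable (\<lambda>n. x ^ n / fact n powr q)"
proof -
  have "((\<lambda>n. \<bar>x\<bar> / (real n + 1) powr q) \<longlongrightarrow> 0) sequentially"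
    using assms by real_asymp
  then have "\<forall>\<^sub>F n in sequentially. \<bar>x\<bar> / (real n + 1) powr q < 1 / 2"
    by (rule order_tendstoD) simp
  then obtain N where N: "\<And>n. n \<ge> N \<Longrightarrow> \<bar>x\<bar> / (real n + 1) powr q < 1 / 2"
    by (auto simp: eventually_at_top_linorder)
  show ?thesis
  proof (rule summable_ratio_test)
    fix n assume "n \<ge> N"
    have "norm (x ^ Suc n / fact (Suc n) powr q) =
        (\<bar>x\<bar> / (real n + 1) powr q) * norm (x ^ n / fact n powr q)"
      by (simp add: abs_mult power_abs powr_mult add.commute)
    also have "\<dots> \<le> 1 / 2 * norm (x ^ n / fact n powr q)"
      using N[OF \<open>n \<ge> N\<close>] by (intro mult_right_mono) auto
    finally show "norm (x ^ Suc n / fact (Suc n) powr q) \<le> 1 / 2 * norm (x ^ n / fact n powr q)" .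
  qed simp
qed

lemma fact_mult_le_fact_add: "fact m * fact n \<le> (fact (m + n) :: real)"
proof -
  have "fact m * fact n \<le> (fact (m + n) :: nat)"
    by (rule dvd_imp_le) (simp_all add: fact_fact_dvd_fact)
  then have "real (fact m * fact n) \<le> real (fact (m + n))"
    by (rule of_nat_mono)
  then show ?thesis by simp
qed

text \<open>From \<open>k! m! \<le> (k + m)!\<close> the tail starting at \<open>k\<close> is dominated by its first term times the whole
  series. The factor \<open>1 / (k!)\<^sup>q\<close> gained here is what later beats the growth of \<open>\<K>\<^sup>k[f](u)\<close>.\<close>

lemma summable_tail_power_over_fact_powr:
  fixes y Y q :: real
  assumes q: "q > 0" and y: "0 \<le> y" "y \<le> Y"
  shows "summable (\<lambda>n. if n < k then 0 else y ^ n / fact n powr q)" (is "summable ?h")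
    and "(\<Sum>n. if n < k then 0 else y ^ n / fact n powr q)
           \<le> Y ^ k / fact k powr q * (\<Sum>m. Y ^ m / fact m powr q)"
proof -
  have sY: "summable (\<lambda>m. Y ^ k / fact k powr q * (Y ^ m / fact m powr q))"
    by (intro summable_mult summable_power_over_fact_powr q)
  have le: "?h (m + k) \<le> Y ^ k / fact k powr q * (Y ^ m / fact m powr q)" for m
  proof -
    have "(fact k * fact m) powr q \<le> (fact (m + k) :: real) powr q"
      using q fact_mult_le_fact_add[of k m] by (intro powr_mono2) (auto simp: add.commute)
    then have "y ^ (m + k) / fact (m + k) powr q \<le> Y ^ (m + k) / (fact k * fact m) powr q"
      using y by (intro frac_le power_mono) auto
    then show ?thesis by (simp add: power_add powr_mult mult.commute)
  qed
  have sh: "summable (\<lambda>m. ?h (m + k))"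
    by (rule summable_comparison_test'[OF sY, of 0]) (use le y in \<open>auto simp: abs_of_nonneg\<close>)
  then show s: "summable ?h" by (rule summable_iff_shift[of ?h k, THEN iffD1])
  have "suminf ?h = (\<Sum>m. ?h (m + k)) + (\<Sum>i<k. ?h i)"
    using s by (rule suminf_split_initial_segment)
  also have "(\<Sum>i<k. ?h i) = 0" by simp
  also have "(\<Sum>m. ?h (m + k)) + 0 \<le> (\<Sum>m. Y ^ k / fact k powr q * (Y ^ m / fact m powr q))"
    using suminf_le[OF le sh sY] by simp
  also have "\<dots> = Y ^ k / fact k powr q * (\<Sum>m. Y ^ m / fact m powr q)"
    by (intro suminf_mult summable_power_over_fact_powr q)
  finally show "suminf ?h \<le> Y ^ k / fact k powr q * (\<Sum>m. Y ^ m / fact m powr q)" .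
qed

text \<open>In the normalisation with coefficients \<open>a n / n!\<close>, differentiation is the shift of \<open>a\<close>.\<close>

lemma funpow_deriv_exponential_series:
  fixes a :: "nat \<Rightarrow> complex"
  assumes "\<And>z. summable (\<lambda>n. a n / fact n * z ^ n)"
  shows "(\<lambda>n. a (n + j) / fact n * z ^ n) sums ((deriv ^^ j) (\<lambda>z. \<Sum>n. a n / fact n * z ^ n) z)"
proof -
  define F where "F = (\<lambda>j z. \<Sum>n. a (n + j) / fact n * z ^ n)"
  have diffs: "diffs (\<lambda>n. a (n + j) / fact n) = (\<lambda>n. a (n + Suc j) / fact n)" for j
    by (rule ext) (simp add: diffs_def del: of_nat_Suc)
  have summ: "summable (\<lambda>n. a (n + j) / fact n * z ^ n)" for j z
  proof (induction j arbitrary: z)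
    case 0
    show ?case using assms by simp
  next
    case (Suc j)
    show ?case
      using termdiff_converges_all[of "\<lambda>n. a (n + j) / fact n" z] Suc by (simp only: diffs)
  qed
  have der: "deriv (F j) = F (Suc j)" for j
  proof
    fix z
    have "(F j has_field_derivative F (Suc j) z) (at z)"
      using termdiffs_strong_converges_everywhere[of "\<lambda>n. a (n + j) / fact n" z] summ
      by (simp only: diffs F_def)
    then show "deriv (F j) z = F (Suc j) z" by (rule DERIV_imp_deriv)
  qed
  have "(deriv ^^ j) (F 0) = F j"
    by (induction j) (simp_all add: der)
  then have "(deriv ^^ j) (\<lambda>z. \<Sum>n. a n / fact n * z ^ n) z = (\<Sum>n. a (n + j) / fact n * z ^ n)"
    by (simp add: F_def)
  with summ[of j z] show ?thesis by (simp add: summable_sums)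
qed

text \<open>Fubini for a double series whose columns are finite, so that the inner sums after the
  interchange are ordinary finite sums.\<close>

lemma sums_swap_triangular:
  fixes g :: "nat \<Rightarrow> nat \<Rightarrow> complex"
  assumes rows: "\<And>k. summable (\<lambda>n. norm (g k n))"
    and total: "summable (\<lambda>k. \<Sum>n. norm (g k n))"
    and zero: "\<And>k n. n < k \<Longrightarrow> g k n = 0"
  shows "(\<lambda>n. \<Sum>k\<le>n. g k n) sums (\<Sum>k. \<Sum>n. g k n)"
proof -
  have nrow: "(\<Sum>\<^sub>\<infinity>n. norm (g k n)) = (\<Sum>n. norm (g k n))" for k
    using rows[of k] by (intro infsumI norm_summable_imp_has_sum) (auto simp: summable_sums)
  have row: "(\<Sum>\<^sub>\<infinity>n. g k n) = (\<Sum>n. g k n)" for k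
    using rows[of k]
    by (intro infsumI norm_summable_imp_has_sum) (auto intro: summable_sums summable_norm_cancel)
  have col: "(\<Sum>\<^sub>\<infinity>k. g k n) = (\<Sum>k\<le>n. g k n)" for n
  proof -
    have "(\<Sum>\<^sub>\<infinity>k. g k n) = (\<Sum>\<^sub>\<infinity>k\<in>{..n}. g k n)"
      by (rule infsum_cong_neutral) (auto intro: zero)
    then show ?thesis by simp
  qed
  have tot: "summable (\<lambda>k. norm (\<Sum>n. norm (g k n)))"
    using total rows by (simp add: suminf_nonneg)
  have "(\<lambda>n. norm (g k n)) summable_on UNIV" for k
    using rows[of k] by (intro norm_summable_imp_summable_on) simp
  moreover have "(\<lambda>k. norm (\<Sum>\<^sub>\<infinity>n. norm (g k n))) summable_on UNIV"
    unfolding nrow using tot by (intro norm_summable_imp_summable_on) simp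
  ultimately have "(\<lambda>x. norm (case x of (k, n) \<Rightarrow> g k n)) summable_on (UNIV \<times> UNIV)"
    by (subst Infinite_Sum.abs_summable_on_Sigma_iff) simp
  then have S: "(\<lambda>(k, n). g k n) summable_on (UNIV \<times> UNIV)"
    by (rule Infinite_Sum.abs_summable_summable)
  then have S': "(\<lambda>(n, k). g k n) summable_on (UNIV \<times> UNIV)"
    using summable_on_reindex_bij_betw[OF bij_swap, of "\<lambda>(k, n). g k n"]
    by (simp add: case_prod_unfold)
  have eq: "(\<Sum>\<^sub>\<infinity>k. \<Sum>\<^sub>\<infinity>n. g k n) = (\<Sum>\<^sub>\<infinity>n. \<Sum>\<^sub>\<infinity>k. g k n)"
    using S by (rule infsum_swap_banach)
  have "(\<lambda>k. \<Sum>\<^sub>\<infinity>n. g k n) summable_on UNIV"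
    using summable_on_Sigma_banach[OF S] by simp
  then have s1: "(\<lambda>k. \<Sum>n. g k n) sums (\<Sum>\<^sub>\<infinity>k. \<Sum>\<^sub>\<infinity>n. g k n)"
    unfolding row by (intro has_sum_imp_sums has_sum_infsum)
  have "(\<lambda>n. \<Sum>\<^sub>\<infinity>k. g k n) summable_on UNIV"
    using summable_on_Sigma_banach[OF S'] by simp
  then have s2: "(\<lambda>n. \<Sum>k\<le>n. g k n) sums (\<Sum>\<^sub>\<infinity>n. \<Sum>\<^sub>\<infinity>k. g k n)"
    unfolding col by (intro has_sum_imp_sums has_sum_infsum)
  show ?thesis
    using s2 unfolding eq[symmetric] sums_unique[OF s1] .
qed

section \<open>The moment transform as a power series\<close>

text \<open>An absolute moment of odd order is not a moment. This inequality controls it, after division by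
  \<open>n!\<close>, by the two neighbouring moments of even order: the right-hand side keeps only the terms of
  even order, as \<open>a\<^sup>k + (- a)\<^sup>k\<close> vanishes for odd \<open>k\<close>. For odd \<open>n\<close>, dividing by
  \<open>\<bar>a\<bar>\<^bsup>n - 1\<^esup> / (n - 1)!\<close> reduces the claim to \<open>b / n \<le> 1 + b\<^sup>2 / (n (n + 1))\<close> with \<open>b = \<bar>a\<bar>\<close>, a
  quadratic inequality in \<open>b\<close>.\<close>

lemma power_over_fact_le_even_terms:
  fixes a :: real
  shows "\<bar>a\<bar> ^ n / fact n \<le> (a ^ (n - 1) + (- a) ^ (n - 1)) / (2 * fact (n - 1))
      + (a ^ n + (- a) ^ n) / (2 * fact n) + (a ^ Suc n + (- a) ^ Suc n) / (2 * fact (Suc n))"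
proof (cases "even n")
  case True
  have nonneg: "0 \<le> a ^ k + (- a) ^ k" for k
    by (cases "even k") (simp_all add: zero_le_even_power)
  have "\<bar>a\<bar> ^ n / fact n = (a ^ n + (- a) ^ n) / (2 * fact n)"
    using True by (simp add: power_even_abs)
  then show ?thesis
    using nonneg[of "n - 1"] nonneg[of "Suc n"] by (simp del: power_Suc fact_Suc)
next
  case False
  then obtain m where m: "n = Suc (2 * m)" by (metis oddE Suc_eq_plus1)
  define b where "b = \<bar>a\<bar>"
  define x where "x = real n"
  have x: "x \<ge> 1" using m by (simp add: x_def)
  have facts: "fact n = fact (2 * m) * x" "fact (Suc n) = fact (2 * m) * x * (x + 1)"
    by (simp_all add: m x_def algebra_simps)
  \<comment> \<open>The quadratic \<open>b\<^sup>2 - (x + 1) b + x (x + 1)\<close>, written as a sum of nonnegative terms.\<close>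
  have "0 \<le> (b - x) * (b - x) + (x - 1) * b + x" "0 \<le> b"
    using x by (auto simp: b_def)
  then have quad: "b * (x + 1) \<le> x * (x + 1) + b * b"
    by (simp add: algebra_simps)
  have "b ^ (2 * m) * (b * (x + 1)) \<le> b ^ (2 * m) * (x * (x + 1) + b * b)"
    by (rule mult_left_mono[OF quad]) (simp add: b_def)
  then have "b ^ (2 * m) * (b * (x + 1)) / (fact (2 * m) * x * (x + 1))
      \<le> b ^ (2 * m) * (x * (x + 1) + b * b) / (fact (2 * m) * x * (x + 1))"
    using x by (intro divide_right_mono) auto
  also have "b ^ (2 * m) * (b * (x + 1)) / (fact (2 * m) * x * (x + 1)) = b ^ n / fact n"
    using x by (simp add: facts divide_simps) (simp add: m)
  also have "b ^ (2 * m) * (x * (x + 1) + b * b) / (fact (2 * m) * x * (x + 1))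
      = b ^ (2 * m) / fact (2 * m) + b ^ Suc n / fact (Suc n)"
    using x by (simp add: facts divide_simps) (simp add: m x_def algebra_simps)
  finally show ?thesis
    by (simp add: m b_def power_even_abs)
qed

text \<open>Term-by-term integration of the exponential series. The interchange needs the absolute moments
  \<open>\<integral>\<bar>\<omega>\<bar>\<^sup>n\<close>; \<open>power_over_fact_le_even_terms\<close> bounds them by the moments of even order, which the growth
  hypothesis controls.\<close>

lemma moment_transform_sums:
  assumes dist: "moment_distribution \<M> \<alpha>"
    and growth: "\<And>x. summable (\<lambda>n. moment \<M> n / fact n * x ^ n)"
  shows "(\<lambda>n. (\<i> ^ n * of_real (moment \<M> n)) / fact n * z ^ n) sums moment_transform \<alpha> z"
proof -
  define \<mu> where "\<mu> = stieltjes_measure \<alpha>"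
  have int: "integrable \<mu> (\<lambda>\<omega>. \<omega> ^ n)" and mom: "moment \<M> n = (LINT \<omega>|\<mu>. \<omega> ^ n)" for n
    using dist by (auto simp: moment_distribution_def \<mu>_def)
  define f :: "nat \<Rightarrow> real \<Rightarrow> complex" where
    "f = (\<lambda>n \<omega>. (\<i> * z) ^ n / fact n * of_real (\<omega> ^ n))"
  have intf: "integrable \<mu> (f n)" for n
    unfolding f_def by (intro integrable_mult_right integrable_of_real int)
  have fint: "integral\<^sup>L \<mu> (f n) = (\<i> ^ n * of_real (moment \<M> n)) / fact n * z ^ n" for n
    unfolding f_def mom integral_mult_right_zero integral_complex_of_real
    by (simp add: power_mult_distrib)
  have expf: "(\<lambda>n. f n \<omega>) sums exp (\<i> * of_real \<omega> * z)" for \<omega>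
    using exp_converges[of "\<i> * of_real \<omega> * z"]
    by (simp add: f_def power_mult_distrib scaleR_conv_of_real field_simps)
  have normf: "norm (f n \<omega>) = norm z ^ n / fact n * \<bar>\<omega>\<bar> ^ n" for n \<omega>
    by (simp add: f_def norm_mult norm_power norm_divide power_abs)
  have "summable (\<lambda>n. norm (f n \<omega>))" for \<omega>
    using summable_exp[of "norm z * \<bar>\<omega>\<bar>"]
    by (simp add: normf power_mult_distrib field_simps)
  moreover have "summable (\<lambda>n. \<integral>\<omega>. norm (f n \<omega>) \<partial>\<mu>)"
  proof -
    define t where "t = norm z"
    define H where "H = (\<lambda>n. (moment \<M> n / fact n * t ^ n + moment \<M> n / fact n * (- t) ^ n) / 2)"
    have "summable H"
      unfolding H_def by (intro summable_divide summable_add growth)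
    \<comment> \<open>The \<open>n\<close>-th term of the power series of \<open>cosh\<close>; its integral involves no absolute values.\<close>
    define h :: "nat \<Rightarrow> real \<Rightarrow> real" where "h = (\<lambda>n a. (a ^ n + (- a) ^ n) / (2 * fact n))"
    have h_eq: "h n (t * \<omega>) = (t ^ n + (- t) ^ n) / (2 * fact n) * \<omega> ^ n" for n \<omega>
      unfolding h_def minus_mult_left power_mult_distrib by (simp flip: distrib_right)
    have inth: "integrable \<mu> (\<lambda>\<omega>. h n (t * \<omega>))" for n
      unfolding h_eq by (intro integrable_mult_right int)
    have H: "(\<integral>\<omega>. h n (t * \<omega>) \<partial>\<mu>) = H n" for n
      unfolding h_eq integral_mult_right_zero by (simp add: H_def mom field_simps)
    have bound: "norm (\<integral>\<omega>. norm (f n \<omega>) \<partial>\<mu>) \<le> H (n - 1) + H n + H (Suc n)" for n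
    proof -
      have "(\<integral>\<omega>. norm (f n \<omega>) \<partial>\<mu>) \<le> (\<integral>\<omega>. h (n - 1) (t * \<omega>) + h n (t * \<omega>) + h (Suc n) (t * \<omega>) \<partial>\<mu>)"
      proof (intro integral_mono Bochner_Integration.integrable_add integrable_norm intf inth)
        fix \<omega>
        have "norm (f n \<omega>) = \<bar>t * \<omega>\<bar> ^ n / fact n"
          by (simp add: normf t_def abs_mult power_mult_distrib)
        also have "\<dots> \<le> h (n - 1) (t * \<omega>) + h n (t * \<omega>) + h (Suc n) (t * \<omega>)"
          unfolding h_def by (rule power_over_fact_le_even_terms)
        finally show "norm (f n \<omega>) \<le> h (n - 1) (t * \<omega>) + h n (t * \<omega>) + h (Suc n) (t * \<omega>)" .
      qed
      then show ?thesis by (simp add: H inth)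
    qed
    have "summable (\<lambda>n. H (n - 1) + H n + H (Suc n))"
      using \<open>summable H\<close> summable_Suc_iff[of "\<lambda>n. H (n - 1)"]
      by (intro summable_add) (simp_all add: summable_Suc_iff)
    then show ?thesis
      by (rule summable_comparison_test') (use bound in auto)
  qed
  ultimately have "(\<lambda>n. integral\<^sup>L \<mu> (f n)) sums (\<integral>\<omega>. (\<Sum>n. f n \<omega>) \<partial>\<mu>)"
    using intf by (intro sums_integral) auto
  then show ?thesis
    unfolding fint sums_unique[OF expf, symmetric] by (simp only: moment_transform_def \<mu>_def)
qed

section \<open>Orthonormal polynomials of a weakly bounded functional\<close>

text \<open>The constants \<open>B\<close> and \<open>p\<close> that witness weak boundedness are fixed as parameters, because all
  later bounds are explicit in them.\<close>

locale weakly_bounded_system =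
  fixes \<M> :: "real poly \<Rightarrow> real" and P :: "nat \<Rightarrow> real poly" and \<gamma> \<beta> :: "nat \<Rightarrow> real"
    and B p :: real
  assumes add: "\<M> (a + b) = \<M> a + \<M> b"
    and smult: "\<M> (Polynomial.smult c a) = c * \<M> a"
    and polys: "orthonormal_polys \<M> P \<gamma> \<beta>"
    and B: "B \<ge> 1" and p: "0 \<le> p" "p < 1"
    and \<gamma>_lower: "(1 / B) * (real n + 1) powr p \<le> \<gamma> n"
    and \<gamma>_upper: "\<gamma> n \<le> B * (real n + 1) powr p"
    and \<beta>_bound: "\<bar>\<beta> n\<bar> / \<gamma> n \<le> B"
begin

lemma degree_P: "Polynomial.degree (P n) = n"
  and orthonormal: "\<M> (P n * P m) = (if m = n then 1 else 0)"
  and P_0: "P 0 = 1"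
  and \<gamma>_pos: "\<gamma> n > 0"
  and P_Suc: "P (Suc n) = Polynomial.smult (1 / \<gamma> n) ([:\<beta> n, 1:] * P n)
                       - (if n = 0 then 0 else Polynomial.smult (\<gamma> (n - 1) / \<gamma> n) (P (n - 1)))"
  using polys by (simp_all add: orthonormal_polys_def)

lemma functional_zero: "\<M> 0 = 0"
  using smult[of 0 0] by simp

lemma functional_diff: "\<M> (a - b) = \<M> a - \<M> b"
  using add[of "a - b" b] by simp

lemma functional_sum: "\<M> (sum g A) = (\<Sum>x\<in>A. \<M> (g x))"
  by (induction A rule: infinite_finite_induct) (simp_all add: functional_zero add)

text \<open>Since \<open>P k\<close> has degree exactly \<open>k\<close>, the first \<open>n + 1\<close> of them span the polynomials of degree at most
  \<open>n\<close>; orthonormality then identifies the coefficients.\<close>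

lemma orthonormal_expansion:
  assumes "Polynomial.degree q \<le> n"
  shows "q = (\<Sum>k\<le>n. Polynomial.smult (\<M> (q * P k)) (P k))"
proof -
  have "\<exists>d. q = (\<Sum>k\<le>n. Polynomial.smult (d k) (P k))"
    using assms
  proof (induction n arbitrary: q)
    case 0
    then obtain a where "q = [:a:]" by (auto elim: degree_eq_zeroE)
    then show ?case by (intro exI[of _ "\<lambda>_. a"]) (simp add: P_0)
  next
    case (Suc n)
    define c where "c = Polynomial.coeff q (Suc n) / Polynomial.coeff (P (Suc n)) (Suc n)"
    have lead: "Polynomial.coeff (P (Suc n)) (Suc n) \<noteq> 0"
      using degree_P[of "Suc n"] by (metis leading_coeff_0_iff degree_0 nat.distinct(1))
    have "Polynomial.degree (q - Polynomial.smult c (P (Suc n))) \<le> n"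
    proof (rule degree_le, intro allI impI)
      fix i assume "n < i"
      show "Polynomial.coeff (q - Polynomial.smult c (P (Suc n))) i = 0"
      proof (cases "i = Suc n")
        case True
        then show ?thesis using lead by (simp add: c_def)
      next
        case False
        with \<open>n < i\<close> have "i > Suc n" by simp
        then show ?thesis using Suc.prems degree_P[of "Suc n"] by (simp add: coeff_eq_0)
      qed
    qed
    then obtain d where d: "q - Polynomial.smult c (P (Suc n)) = (\<Sum>k\<le>n. Polynomial.smult (d k) (P k))"
      using Suc.IH by blast
    have "q = (\<Sum>k\<le>Suc n. Polynomial.smult ((d(Suc n := c)) k) (P k))"
      using d by (simp add: algebra_simps)
    then show ?case by blast
  qed
  then obtain d where d: "q = (\<Sum>k\<le>n. Polynomial.smult (d k) (P k))" by blast
  have "\<M> (q * P k) = d k" if "k \<le> n" for k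
    using that by (simp add: d sum_distrib_right functional_sum smult orthonormal
        if_distrib[of "\<lambda>x. _ * x"] cong: if_cong)
  then show ?thesis using d by simp
qed

text \<open>The coefficient of \<open>P k\<close> in the expansion of \<open>\<omega>\<^sup>n\<close>.\<close>

definition mixed_moment :: "nat \<Rightarrow> nat \<Rightarrow> real" where
  "mixed_moment n k = \<M> (Polynomial.monom 1 n * P k)"

text \<open>Monomials of degree below \<open>k\<close> lie in the span of \<open>P 0, \<dots>, P (k - 1)\<close>, hence are orthogonal to \<open>P k\<close>.\<close>

lemma mixed_moment_eq_0:
  assumes "n < k"
  shows "mixed_moment n k = 0"
proof -
  have "Polynomial.degree (Polynomial.monom (1::real) n) \<le> n"
    by (rule degree_monom_le)
  then have "Polynomial.monom 1 n = (\<Sum>j\<le>n. Polynomial.smult (\<M> (Polynomial.monom 1 n * P j)) (P j))"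
    by (rule orthonormal_expansion)
  then have "mixed_moment n k = \<M> ((\<Sum>j\<le>n. Polynomial.smult (\<M> (Polynomial.monom 1 n * P j)) (P j)) * P k)"
    by (simp add: mixed_moment_def)
  also have "\<dots> = 0"
    using assms by (auto simp: sum_distrib_right functional_sum smult orthonormal intro!: sum.neutral)
  finally show ?thesis .
qed

text \<open>Comparing coefficients in the orthonormal expansion of \<open>\<omega>\<^sup>n\<close> shows that the mixed moments and the
  coefficients of the orthonormal polynomials are inverse triangular matrices. This is the identity
  that turns the chromatic expansion into the Taylor expansion.\<close>

lemma mixed_moment_inverse:
  "(\<Sum>k\<le>n. mixed_moment n k * Polynomial.coeff (P k) j) = (if j = n then 1 else 0)"
proof -
  have "Polynomial.degree (Polynomial.monom (1::real) n) \<le> n"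
    by (rule degree_monom_le)
  from orthonormal_expansion[OF this]
  have "Polynomial.coeff (Polynomial.monom 1 n) j =
      Polynomial.coeff (\<Sum>k\<le>n. Polynomial.smult (mixed_moment n k) (P k)) j"
    by (simp add: mixed_moment_def)
  then show ?thesis by (auto simp: Polynomial.coeff_sum)
qed

lemma mixed_moment_0: "mixed_moment 0 k = (if k = 0 then 1 else 0)"
  using orthonormal[of 0 k] by (simp add: mixed_moment_def P_0)

lemma mixed_moment_0_right: "mixed_moment n 0 = moment \<M> n"
  by (simp add: mixed_moment_def moment_def P_0)

lemma mixed_moment_eq_sum_moments:
  "mixed_moment n k = (\<Sum>j\<le>k. Polynomial.coeff (P k) j * moment \<M> (n + j))"
proof -
  have "Polynomial.monom 1 n * P k =
      Polynomial.monom 1 n * (\<Sum>j\<le>k. Polynomial.monom (Polynomial.coeff (P k) j) j)"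
    using poly_as_sum_of_monoms[of "P k"] by (simp add: degree_P)
  also have "\<dots> = (\<Sum>j\<le>k. Polynomial.smult (Polynomial.coeff (P k) j) (Polynomial.monom 1 (n + j)))"
    by (simp add: sum_distrib_left mult_monom smult_monom)
  finally show ?thesis
    by (simp add: mixed_moment_def moment_def functional_sum smult)
qed

lemma pCons_0_P:
  "pCons 0 (P n) = Polynomial.smult (\<gamma> n) (P (Suc n)) - Polynomial.smult (\<beta> n) (P n)
     + (if n = 0 then 0 else Polynomial.smult (\<gamma> (n - 1)) (P (n - 1)))"
  using \<gamma>_pos[of n] by (simp add: P_Suc smult_diff_right)

text \<open>The matrix of multiplication by \<open>\<omega>\<close> in the orthonormal basis is tridiagonal, so a mixed moment is a
  sum over lattice paths whose steps carry the weights \<open>\<gamma>\<close> and \<open>\<beta>\<close>.\<close>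

lemma mixed_moment_Suc:
  "mixed_moment (Suc n) k = \<gamma> k * mixed_moment n (Suc k) - \<beta> k * mixed_moment n k
     + (if k = 0 then 0 else \<gamma> (k - 1) * mixed_moment n (k - 1))"
proof -
  have "Polynomial.monom 1 (Suc n) * P k = Polynomial.monom 1 n * pCons 0 (P k)"
    by (simp add: monom_Suc)
  then show ?thesis
    unfolding mixed_moment_def pCons_0_P
    by (simp add: distrib_left right_diff_distrib add functional_diff smult functional_zero)
qed

text \<open>The recurrences for the mixed moments and for the coefficients of the polynomials have three terms
  each, and \<open>B\<^sup>2\<close> bounds each of their weights once a power of \<open>n + 1\<close> is split off.\<close>

definition C :: real where "C = 3 * B\<^sup>2"

lemma C_ge: "C \<ge> 3"
  using B by (simp add: C_def)

lemma shrunk_radius_le: "R \<ge> 0 \<Longrightarrow> R / (2 * C\<^sup>2) \<le> R"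
  using C_ge mult_mono[of 3 C 3 C] divide_left_mono[of 1 "2 * C\<^sup>2" R]
  by (simp add: power2_eq_square)

lemma B_le_square: "B \<le> B\<^sup>2"
  using B by (simp add: power2_eq_square)

lemma abs_\<beta>_le: "\<bar>\<beta> n\<bar> \<le> B\<^sup>2 * (real n + 1) powr p"
proof -
  have "\<bar>\<beta> n\<bar> \<le> B * \<gamma> n"
    using \<beta>_bound[of n] \<gamma>_pos[of n] by (simp add: field_simps)
  also have "\<dots> \<le> B * (B * (real n + 1) powr p)"
    using \<gamma>_upper[of n] B by (intro mult_left_mono) auto
  finally show ?thesis by (simp add: power2_eq_square mult.assoc)
qed

lemma \<gamma>_le: "\<gamma> n \<le> B\<^sup>2 * (real n + 1) powr p"
  by (rule order_trans[OF \<gamma>_upper mult_right_mono[OF B_le_square]]) simp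

text \<open>In the recurrence for \<open>n + 1\<close>, every nonvanishing term has its weight \<open>\<gamma>\<close> or \<open>\<beta>\<close> taken at an index at
  most \<open>n\<close>, because mixed moments vanish above the diagonal. So one step costs at most
  \<open>C (n + 1)\<^sup>p\<close>, and the factors multiply up to \<open>C\<^sup>n (n!)\<^sup>p\<close>.\<close>

lemma abs_mixed_moment_le: "\<bar>mixed_moment n k\<bar> \<le> C ^ n * fact n powr p"
proof (induction n arbitrary: k)
  case 0
  then show ?case by (simp add: mixed_moment_0)
next
  case (Suc n)
  show ?case
  proof (cases "k \<le> Suc n")
    case False
    then show ?thesis using C_ge by (simp add: mixed_moment_eq_0)
  next
    case True
    define W where "W = B\<^sup>2 * (real (Suc n)) powr p"
    define S where "S = C ^ n * fact n powr p"
    have S: "\<bar>mixed_moment n i\<bar> \<le> S" for i using Suc.IH by (simp add: S_def)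
    have nn: "0 \<le> W" "0 \<le> S" using C_ge by (simp_all add: W_def S_def)
    have weight: "B\<^sup>2 * (real i + 1) powr p \<le> W" if "i \<le> n" for i
      unfolding W_def using that p by (intro mult_left_mono powr_mono2) auto
    have a: "\<bar>\<gamma> k * mixed_moment n (Suc k)\<bar> \<le> W * S"
    proof (cases "k < n")
      case True
      then show ?thesis
        using \<gamma>_le[of k] weight[of k] \<gamma>_pos[of k] S nn
        unfolding abs_mult by (intro mult_mono) auto
    next
      case False
      then show ?thesis using nn by (simp add: mixed_moment_eq_0)
    qed
    have b: "\<bar>\<beta> k * mixed_moment n k\<bar> \<le> W * S"
    proof (cases "k \<le> n")
      case True
      then show ?thesis
        using abs_\<beta>_le[of k] weight[of k] S nn
        unfolding abs_mult by (intro mult_mono) auto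
    next
      case False
      then show ?thesis using nn by (simp add: mixed_moment_eq_0)
    qed
    have c: "\<bar>if k = 0 then 0 else \<gamma> (k - 1) * mixed_moment n (k - 1)\<bar> \<le> W * S"
    proof (cases "k = 0")
      case True
      then show ?thesis using nn by simp
    next
      case False
      then have "k - 1 \<le> n" using True by simp
      then have "\<bar>\<gamma> (k - 1) * mixed_moment n (k - 1)\<bar> \<le> W * S"
        using \<gamma>_le[of "k - 1"] weight[of "k - 1"] \<gamma>_pos[of "k - 1"] S nn
        unfolding abs_mult by (intro mult_mono) auto
      then show ?thesis using False by simp
    qed
    have "\<bar>mixed_moment (Suc n) k\<bar> \<le> 3 * (W * S)"
      unfolding mixed_moment_Suc using a b c by linarith
    also have "\<dots> = C ^ Suc n * fact (Suc n) powr p"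
      by (simp add: W_def S_def C_def powr_mult)
    finally show ?thesis .
  qed
qed

text \<open>Raising the degree from \<open>j - 1\<close> to \<open>j\<close> at level \<open>k' + 1\<close> costs a factor \<open>1 / \<gamma> k' \<le> B / (k' + 1)\<^sup>p\<close>.
  As \<open>j \<le> k' + 1\<close>, this is at most \<open>B / j\<^sup>p\<close>, which turns \<open>1 / ((j - 1)!)\<^sup>p\<close> into \<open>1 / (j!)\<^sup>p\<close>.
  The other two coefficients of the recurrence, \<open>\<beta> k' / \<gamma> k'\<close> and \<open>\<gamma> (k' - 1) / \<gamma> k'\<close>, are bounded by
  \<open>B\<^sup>2\<close>.\<close>

lemma abs_coeff_P_le: "\<bar>Polynomial.coeff (P k) j\<bar> \<le> C ^ k / fact j powr p"
proof (induction k arbitrary: j rule: less_induct)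
  case (less k)
  consider "k = 0" | "k < j" | k' where "k = Suc k'" "j \<le> Suc k'"
    by (metis not0_implies_Suc not_le)
  then show ?case
  proof cases
    case 1
    then show ?thesis by (cases j) (simp_all add: P_0)
  next
    case 2
    then show ?thesis using C_ge by (simp add: coeff_eq_0 degree_P)
  next
    case 3
    define S where "S = B\<^sup>2 * (C ^ k' / fact j powr p)"
    have S: "0 \<le> S" using C_ge by (simp add: S_def)
    have IH: "\<bar>Polynomial.coeff (P k') i\<bar> \<le> C ^ k' / fact i powr p" for i
      using less 3 by simp
    define g where "g = \<gamma> k'"
    have g: "g > 0" "1 / g \<le> B / (real k' + 1) powr p"
      using \<gamma>_pos[of k'] \<gamma>_lower[of k'] B by (auto simp: g_def field_simps)
    have a: "\<bar>(if j = 0 then 0 else Polynomial.coeff (P k') (j - 1)) / g\<bar> \<le> S"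
    proof (cases j)
      case 0
      then show ?thesis using S by simp
    next
      case (Suc i)
      have "\<bar>Polynomial.coeff (P k') i / g\<bar> = (1 / g) * \<bar>Polynomial.coeff (P k') i\<bar>"
        using g by simp
      also have "\<dots> \<le> (B / (real k' + 1) powr p) * (C ^ k' / fact i powr p)"
        using g IH B by (intro mult_mono) auto
      also have "\<dots> \<le> (B\<^sup>2 / (real j) powr p) * (C ^ k' / fact i powr p)"
        using B_le_square B C_ge 3 Suc p
        by (intro mult_right_mono frac_le powr_mono2) auto
      also have "\<dots> = S"
        by (simp add: S_def Suc powr_mult)
      finally show ?thesis by (simp add: Suc)
    qed
    have b: "\<bar>\<beta> k' * Polynomial.coeff (P k') j / g\<bar> \<le> S"
    proof -
      have "\<bar>\<beta> k' * Polynomial.coeff (P k') j / g\<bar> = (\<bar>\<beta> k'\<bar> / g) * \<bar>Polynomial.coeff (P k') j\<bar>"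
        using g by (simp add: abs_mult)
      also have "\<dots> \<le> B\<^sup>2 * (C ^ k' / fact j powr p)"
        using \<beta>_bound[of k'] B_le_square IH B by (intro mult_mono) (auto simp: g_def)
      finally show ?thesis by (simp add: S_def)
    qed
    have c: "\<bar>if k' = 0 then 0 else \<gamma> (k' - 1) / g * Polynomial.coeff (P (k' - 1)) j\<bar> \<le> S"
    proof (cases k')
      case 0
      then show ?thesis using S by simp
    next
      case (Suc i)
      have "\<gamma> i \<le> B * (real i + 1) powr p" by (rule \<gamma>_upper)
      also have "\<dots> \<le> B * (real k' + 1) powr p"
        using B p Suc by (intro mult_left_mono powr_mono2) auto
      also have "\<dots> \<le> B * (B * g)"
        using \<gamma>_lower[of k'] B by (intro mult_left_mono) (auto simp: g_def field_simps)
      finally have ratio: "\<gamma> i / g \<le> B\<^sup>2"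
        using g by (simp add: field_simps power2_eq_square)
      have "\<bar>\<gamma> i / g * Polynomial.coeff (P i) j\<bar> = \<gamma> i / g * \<bar>Polynomial.coeff (P i) j\<bar>"
        using g \<gamma>_pos[of i] by (simp add: abs_mult)
      also have "\<dots> \<le> B\<^sup>2 * (C ^ i / fact j powr p)"
        using ratio less.IH[of i j] 3 Suc by (intro mult_mono) auto
      also have "\<dots> \<le> S"
        unfolding S_def using C_ge Suc by (intro mult_left_mono divide_right_mono power_increasing) auto
      finally show ?thesis by (simp add: Suc)
    qed
    have "Polynomial.coeff (P k) j = (if j = 0 then 0 else Polynomial.coeff (P k') (j - 1)) / g
        + \<beta> k' * Polynomial.coeff (P k') j / g
        - (if k' = 0 then 0 else \<gamma> (k' - 1) / g * Polynomial.coeff (P (k' - 1)) j)"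
      unfolding \<open>k = Suc k'\<close> P_Suc g_def using \<gamma>_pos[of k']
      by (cases j) (auto simp: coeff_pCons field_simps)
    then have "\<bar>Polynomial.coeff (P k) j\<bar> \<le> 3 * S"
      using a b c by linarith
    then show ?thesis by (simp add: S_def C_def \<open>k = Suc k'\<close>)
  qed
qed


section \<open>Convergence of the chromatic expansion\<close>

lemma fact_powr_over_fact: "fact n powr p / fact n = 1 / (fact n :: real) powr (1 - p)"
  by (simp add: powr_diff)

lemma summable_moment_series: "summable (\<lambda>n. moment \<M> n / fact n * x ^ n)"
proof (rule summable_comparison_test')
  show "summable (\<lambda>n. (C * \<bar>x\<bar>) ^ n / fact n powr (1 - p))"
    using p by (intro summable_power_over_fact_powr) simp
  fix n
  have "norm (moment \<M> n / fact n * x ^ n) = \<bar>mixed_moment n 0\<bar> / fact n * \<bar>x\<bar> ^ n"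
    by (simp add: mixed_moment_0_right abs_mult power_abs)
  also have "\<dots> \<le> (C ^ n * fact n powr p) / fact n * \<bar>x\<bar> ^ n"
    by (intro mult_right_mono divide_right_mono abs_mixed_moment_le) auto
  also have "\<dots> = (C * \<bar>x\<bar>) ^ n * (fact n powr p / fact n)"
    by (simp add: power_mult_distrib)
  finally show "norm (moment \<M> n / fact n * x ^ n) \<le> (C * \<bar>x\<bar>) ^ n / fact n powr (1 - p)"
    by (simp only: fact_powr_over_fact) simp
qed

text \<open>The operator \<open>p\<^sub>k(-\<i> D)\<close> acts on \<open>e\<^bsup>\<i>\<omega>w\<^esup>\<close> as multiplication by \<open>p\<^sub>k(\<omega>)\<close>. In terms of power series it
  replaces the moments \<open>\<M>(\<omega>\<^sup>n)\<close> by \<open>\<M>(\<omega>\<^sup>n p\<^sub>k)\<close>.\<close>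

lemma chromatic_deriv_moment_transform_sums:
  assumes "moment_distribution \<M> \<alpha>"
  shows "(\<lambda>n. \<i> ^ k * (of_real (mixed_moment n k) * (\<i> * w) ^ n / fact n))
           sums chromatic_deriv P k (moment_transform \<alpha>) w"
proof -
  define a :: "nat \<Rightarrow> complex" where "a = (\<lambda>n. \<i> ^ n * of_real (moment \<M> n))"
  have sums: "(\<lambda>n. a n / fact n * z ^ n) sums moment_transform \<alpha> z" for z
    unfolding a_def using assms summable_moment_series by (rule moment_transform_sums)
  have eq: "moment_transform \<alpha> = (\<lambda>z. \<Sum>n. a n / fact n * z ^ n)"
    using sums by (auto simp: sums_iff)
  have der: "(\<lambda>n. a (n + j) / fact n * w ^ n) sums (deriv ^^ j) (moment_transform \<alpha>) w" for j
    unfolding eq using sums by (intro funpow_deriv_exponential_series) (auto simp: sums_iff)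
  define c where "c = (\<lambda>j. complex_of_real (Polynomial.coeff (P k) j))"
  have "(\<lambda>n. \<i> ^ k * (\<Sum>j\<le>k. c j * (- \<i>) ^ j * (a (n + j) / fact n * w ^ n)))
      sums (\<i> ^ k * (\<Sum>j\<le>k. c j * (- \<i>) ^ j * (deriv ^^ j) (moment_transform \<alpha>) w))"
    by (intro sums_mult sums_sum der)
  moreover have "(\<Sum>j\<le>k. c j * (- \<i>) ^ j * (a (n + j) / fact n * w ^ n))
      = of_real (mixed_moment n k) * (\<i> * w) ^ n / fact n" for n
  proof -
    have cancel: "(- \<i>) ^ j * \<i> ^ (n + j) = \<i> ^ n" for j
      by (simp add: power_add flip: power_mult_distrib)
    have summand: "c j * (- \<i>) ^ j * (a (n + j) / fact n * w ^ n)
        = (c j * of_real (moment \<M> (n + j))) * ((\<i> * w) ^ n / fact n)" for j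
    proof -
      have "c j * (- \<i>) ^ j * (a (n + j) / fact n * w ^ n)
          = ((- \<i>) ^ j * \<i> ^ (n + j)) * (c j * of_real (moment \<M> (n + j))) * (w ^ n / fact n)"
        by (simp add: a_def)
      also have "\<dots> = (c j * of_real (moment \<M> (n + j))) * ((\<i> * w) ^ n / fact n)"
        unfolding cancel by (simp add: power_mult_distrib)
      finally show ?thesis .
    qed
    show ?thesis
      unfolding summand
      by (simp add: mixed_moment_eq_sum_moments c_def sum_distrib_right sum_divide_distrib)
  qed
  ultimately show ?thesis
    by (simp add: chromatic_deriv_def degree_P c_def)
qed

lemma norm_chromatic_deriv_le:
  assumes "\<And>j. norm ((deriv ^^ j) f u) \<le> fact j * A / R ^ j"
  shows "norm (chromatic_deriv P k f u) \<le> A * (\<Sum>j\<le>k. C ^ k * fact j powr (1 - p) / R ^ j)"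
proof -
  have "norm (chromatic_deriv P k f u) =
      norm (\<Sum>j\<le>k. of_real (Polynomial.coeff (P k) j) * (- \<i>) ^ j * (deriv ^^ j) f u)"
    unfolding chromatic_deriv_def degree_P by (simp add: norm_mult norm_power)
  also have "\<dots> \<le> (\<Sum>j\<le>k. norm (of_real (Polynomial.coeff (P k) j) * (- \<i>) ^ j * (deriv ^^ j) f u))"
    by (rule norm_sum)
  also have "\<dots> \<le> (\<Sum>j\<le>k. (C ^ k / fact j powr p) * (fact j * A / R ^ j))"
  proof (rule sum_mono)
    fix j
    have "norm (of_real (Polynomial.coeff (P k) j) * (- \<i>) ^ j * (deriv ^^ j) f u)
        = \<bar>Polynomial.coeff (P k) j\<bar> * norm ((deriv ^^ j) f u)"
      by (simp add: norm_mult norm_power)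
    also have "\<dots> \<le> (C ^ k / fact j powr p) * (fact j * A / R ^ j)"
      using C_ge by (intro mult_mono abs_coeff_P_le assms) auto
    finally show "norm (of_real (Polynomial.coeff (P k) j) * (- \<i>) ^ j * (deriv ^^ j) f u)
        \<le> (C ^ k / fact j powr p) * (fact j * A / R ^ j)" .
  qed
  also have "\<dots> = A * (\<Sum>j\<le>k. C ^ k * fact j powr (1 - p) / R ^ j)"
    by (simp add: sum_distrib_left powr_diff mult_ac)
  finally show ?thesis .
qed

text \<open>The choice \<open>\<bar>w\<bar> < R / (2 C\<^sup>2)\<close> makes \<open>X = C\<^sup>2 \<bar>w\<bar> < R / 2\<close>, so the geometric factor of the Cauchy
  product has ratio \<open>1 / 2\<close>. The resulting majorant is independent of \<open>z\<close>, whence uniform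
  convergence; the same majorant also dominates the rows of the double series and so justifies the
  interchange that identifies the sum with \<open>f\<close>.\<close>

theorem chromatic_expansion_near_centre:
  fixes f :: "complex \<Rightarrow> complex"
  assumes dist: "moment_distribution \<M> \<alpha>" and R: "R > 0" and holf: "f holomorphic_on cball u R"
  shows "uniform_limit (ball u (R / (2 * C\<^sup>2))) (\<lambda>N z. \<Sum>k<N. chromatic_term P \<alpha> f u k z) f sequentially"
proof -
  define q where "q = 1 - p"
  have q: "q > 0" using p by (simp add: q_def)
  have C: "C > 0" using C_ge by simp
  \<comment> \<open>\<open>Y\<close> bounds \<open>C \<bar>w\<bar>\<close> on the disc, so that \<open>C * Y = R / 2\<close> bounds \<open>X\<close>.\<close>
  define Y where "Y = R / (2 * C)"
  have Y: "Y > 0" using R C by (simp add: Y_def)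
  define E where "E = (\<Sum>m. Y ^ m / fact m powr q)"
  have contf: "continuous_on (cball u R) f"
    using holf by (rule holomorphic_on_imp_continuous_on)
  have holb: "f holomorphic_on ball u R"
    using holf ball_subset_cball by (rule holomorphic_on_subset)
  have "bounded (f ` cball u R)"
    using compact_continuous_image[OF contf] by (simp add: compact_imp_bounded)
  then obtain A where "\<forall>y\<in>f ` cball u R. norm y \<le> A"
    unfolding bounded_iff by blast
  then have A: "norm (f x) \<le> A" if "x \<in> cball u R" for x
    using that by blast
  have A0: "A \<ge> 0"
    using A[of u] R norm_ge_zero[of "f u"] by (simp del: norm_ge_zero)
  have derf: "norm ((deriv ^^ j) f u) \<le> fact j * A / R ^ j" for j
    using holb contf R by (rule Cauchy_inequality) (auto intro: A simp: dist_norm)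
  define a where "a = (\<lambda>k. chromatic_deriv P k f u)"
  define majorant where
    "majorant = (\<lambda>k. A * E * (\<Sum>j\<le>k. (1 / 2) ^ j * ((R / 2) ^ (k - j) / fact (k - j) powr q)))"
  have "summable majorant"
    unfolding majorant_def
    using summable_power_over_fact_powr[OF q, of "R / 2"] R
    by (intro summable_mult summable_Cauchy_product) (simp_all add: abs_mult power_abs)
  have E: "E \<ge> 0"
    unfolding E_def using Y by (intro suminf_nonneg summable_power_over_fact_powr q) auto
  have majorant: "norm (a k) * (Y ^ k / fact k powr q * E) \<le> majorant k" for k
  proof -
    have "norm (a k) * (Y ^ k / fact k powr q * E)
        \<le> (A * (\<Sum>j\<le>k. C ^ k * fact j powr q / R ^ j)) * (Y ^ k / fact k powr q * E)"
      unfolding a_def q_def using Y E by (intro mult_right_mono norm_chromatic_deriv_le derf) auto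
    also have "\<dots> = A * E * (\<Sum>j\<le>k. (C * Y) ^ k / R ^ j * (fact j powr q / fact k powr q))"
      by (simp add: sum_distrib_left sum_distrib_right power_mult_distrib mult_ac)
    also have "\<dots> \<le> majorant k"
      unfolding majorant_def
    proof (intro mult_left_mono sum_mono)
      fix j assume "j \<in> {..k}"
      then have j: "j \<le> k" by simp
      have "fact j * fact (k - j) \<le> (fact k :: real)"
        using fact_mult_le_fact_add[of j "k - j"] j by simp
      then have "(fact j * fact (k - j)) powr q \<le> (fact k :: real) powr q"
        using q by (intro powr_mono2) auto
      then have "fact j powr q / fact k powr q \<le> 1 / (fact (k - j) :: real) powr q"
        by (simp add: powr_mult field_simps)
      moreover have "(C * Y) ^ k / R ^ j = (1 / 2) ^ j * (R / 2) ^ (k - j)"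
      proof -
        have "(C * Y) ^ k = (R / 2) ^ j * (R / 2) ^ (k - j)"
          using C j by (simp add: Y_def flip: power_add)
        then show ?thesis using R by (simp add: power_divide)
      qed
      ultimately show "(C * Y) ^ k / R ^ j * (fact j powr q / fact k powr q)
          \<le> (1 / 2) ^ j * ((R / 2) ^ (k - j) / fact (k - j) powr q)"
        using R mult_left_mono[of "fact j powr q / fact k powr q" "1 / fact (k - j) powr q"
            "(1 / 2) ^ j * (R / 2) ^ (k - j)"] by simp
    qed (use A0 E in auto)
    finally show ?thesis .
  qed
  have key: "norm (chromatic_term P \<alpha> f u k z) \<le> majorant k"
      "(\<Sum>k. chromatic_term P \<alpha> f u k z) = f z"
    if z: "z \<in> ball u (R / (2 * C\<^sup>2))" for k z
  proof -
    define w where "w = z - u"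
    define y where "y = C * norm w"
    have y: "0 \<le> y" "y \<le> Y"
    proof -
      have "norm w < R / (2 * C\<^sup>2)"
        using z by (simp add: w_def dist_norm norm_minus_commute)
      then have "C * norm w \<le> C * (R / (2 * C\<^sup>2))"
        using C by (intro mult_left_mono) auto
      also have "\<dots> = Y" using C by (simp add: Y_def power2_eq_square)
      finally show "y \<le> Y" by (simp add: y_def)
    qed (use C in \<open>simp add: y_def\<close>)
    define h where "h = (\<lambda>k n. if n < k then 0 else y ^ n / fact n powr q)"
    define g where "g = (\<lambda>k n. (- 1) ^ k * a k * (\<i> ^ k * (of_real (mixed_moment n k) * (\<i> * w) ^ n / fact n)))"
    have gsums: "g k sums chromatic_term P \<alpha> f u k z" for k
      unfolding g_def chromatic_term_def a_def w_def
      by (intro sums_mult chromatic_deriv_moment_transform_sums dist)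
    have gle: "norm (g k n) \<le> norm (a k) * h k n" for k n
    proof (cases "n < k")
      case True
      then show ?thesis by (simp add: g_def h_def mixed_moment_eq_0)
    next
      case False
      have "norm (g k n) = norm (a k) * (\<bar>mixed_moment n k\<bar> * (norm w ^ n / fact n))"
        by (simp add: g_def norm_mult norm_power norm_divide)
      also have "\<dots> \<le> norm (a k) * ((C ^ n * fact n powr p) * (norm w ^ n / fact n))"
        by (intro mult_left_mono mult_right_mono abs_mixed_moment_le) auto
      also have "\<dots> = norm (a k) * (y ^ n * (fact n powr p / fact n))"
        by (simp add: y_def power_mult_distrib mult_ac)
      also have "\<dots> = norm (a k) * h k n"
        using False by (simp only: fact_powr_over_fact) (simp add: h_def q_def)
      finally show ?thesis .
    qed
    have hsum: "summable (h k)" "suminf (h k) \<le> Y ^ k / fact k powr q * E" for k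
      using summable_tail_power_over_fact_powr[OF q y, of k] by (simp_all add: h_def E_def)
    have grow: "summable (\<lambda>n. norm (g k n))" for k
      by (rule summable_comparison_test'[OF summable_mult[OF hsum(1)[of k], of "norm (a k)"]])
        (use gle in simp)
    have gtot: "(\<Sum>n. norm (g k n)) \<le> majorant k" for k
    proof -
      have "(\<Sum>n. norm (g k n)) \<le> (\<Sum>n. norm (a k) * h k n)"
        by (intro suminf_le gle grow summable_mult hsum)
      also have "\<dots> = norm (a k) * suminf (h k)"
        by (intro suminf_mult hsum)
      also have "\<dots> \<le> norm (a k) * (Y ^ k / fact k powr q * E)"
        by (intro mult_left_mono hsum) simp
      also have "\<dots> \<le> majorant k" by (rule majorant)
      finally show ?thesis .
    qed
    show "norm (chromatic_term P \<alpha> f u k z) \<le> majorant k"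
      using summable_norm[OF grow[of k]] gtot[of k] sums_unique[OF gsums[of k]] by simp
    have "(\<lambda>n. \<Sum>k\<le>n. g k n) sums (\<Sum>k. \<Sum>n. g k n)"
    proof (rule sums_swap_triangular[OF grow])
      show "summable (\<lambda>k. \<Sum>n. norm (g k n))"
        by (rule summable_comparison_test'[OF \<open>summable majorant\<close>])
          (use gtot grow in \<open>simp add: suminf_nonneg\<close>)
      show "g k n = 0" if "n < k" for k n
        using that by (simp add: g_def mixed_moment_eq_0)
    qed
    moreover have "(\<Sum>k\<le>n. g k n) = (deriv ^^ n) f u / fact n * w ^ n" for n
    proof -
      define d where "d = (\<lambda>j. (- \<i>) ^ j * (deriv ^^ j) f u)"
      have a_eq: "a k = \<i> ^ k * (\<Sum>j\<le>n. of_real (Polynomial.coeff (P k) j) * d j)" if "k \<le> n" for k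
      proof -
        have "(\<Sum>j\<le>k. of_real (Polynomial.coeff (P k) j) * d j)
            = (\<Sum>j\<le>n. of_real (Polynomial.coeff (P k) j) * d j)"
          using that by (intro sum.mono_neutral_left) (auto simp: coeff_eq_0 degree_P)
        then show ?thesis
          by (simp add: a_def chromatic_deriv_def degree_P d_def mult.assoc)
      qed
      \<comment> \<open>The alternating sign of the expansion cancels the two powers of \<open>\<i>\<close> in the chromatic derivatives.\<close>
      have sign: "(- 1) ^ k * \<i> ^ k * \<i> ^ k = (1 :: complex)" for k
        by (simp flip: power_mult_distrib)
      have "(\<Sum>k\<le>n. g k n) = (\<Sum>k\<le>n. ((\<i> * w) ^ n / fact n) *
          (\<Sum>j\<le>n. of_real (mixed_moment n k * Polynomial.coeff (P k) j) * d j))"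
      proof (rule sum.cong[OF refl])
        fix k assume "k \<in> {..n}"
        then have "g k n = ((- 1) ^ k * \<i> ^ k * \<i> ^ k) * ((\<i> * w) ^ n / fact n) *
          (of_real (mixed_moment n k) * (\<Sum>j\<le>n. of_real (Polynomial.coeff (P k) j) * d j))"
          by (simp add: g_def a_eq mult_ac)
        then show "g k n = ((\<i> * w) ^ n / fact n) *
          (\<Sum>j\<le>n. of_real (mixed_moment n k * Polynomial.coeff (P k) j) * d j)"
          by (simp only: sign) (simp add: sum_distrib_left mult.assoc)
      qed
      also have "\<dots> = ((\<i> * w) ^ n / fact n) *
          (\<Sum>j\<le>n. of_real (\<Sum>k\<le>n. mixed_moment n k * Polynomial.coeff (P k) j) * d j)"
        unfolding of_real_sum sum_distrib_right sum_distrib_left by (rule sum.swap)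
      also have "\<dots> = ((\<i> * w) ^ n / fact n) * d n"
        by (simp add: mixed_moment_inverse if_distrib[of "\<lambda>x. x * _"] if_distrib[of of_real] cong: if_cong)
      also have "\<dots> = ((\<i> * w) ^ n * (- \<i>) ^ n) * (deriv ^^ n) f u / fact n"
        by (simp add: d_def)
      also have "(\<i> * w) ^ n * (- \<i>) ^ n = w ^ n"
        by (simp add: mult.commute[of \<i> w] mult.assoc flip: power_mult_distrib)
      also have "w ^ n * (deriv ^^ n) f u / fact n = (deriv ^^ n) f u / fact n * w ^ n"
        by simp
      finally show ?thesis .
    qed
    ultimately have "(\<lambda>n. (deriv ^^ n) f u / fact n * w ^ n) sums (\<Sum>k. chromatic_term P \<alpha> f u k z)"
      by (simp add: sums_unique[OF gsums, symmetric])
    moreover have "(\<lambda>n. (deriv ^^ n) f u / fact n * (z - u) ^ n) sums f z"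
    proof (rule holomorphic_power_series[OF holb])
      show "z \<in> ball u R" using z R shrunk_radius_le[of R] by simp
    qed
    ultimately show "(\<Sum>k. chromatic_term P \<alpha> f u k z) = f z"
      by (simp add: w_def sums_unique2)
  qed
  have "uniform_limit (ball u (R / (2 * C\<^sup>2))) (\<lambda>N z. \<Sum>k<N. chromatic_term P \<alpha> f u k z)
      (\<lambda>z. \<Sum>k. chromatic_term P \<alpha> f u k z) sequentially"
    using key(1) \<open>summable majorant\<close> by (rule Weierstrass_m_test)
  then show ?thesis
    by (rule uniform_limit_cong[THEN iffD1, rotated -1]) (auto simp: key(2))
qed

end

theorem theorem5p11:
  fixes \<M> :: "real poly \<Rightarrow> real"
    and \<alpha> :: "real \<Rightarrow> real"
    and P :: "nat \<Rightarrow> real poly"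
    and \<gamma> \<beta> :: "nat \<Rightarrow> real"
  assumes "moment_functional \<M>"
    and "moment_distribution \<M> \<alpha>"
    and "orthonormal_polys \<M> P \<gamma> \<beta>"
    and "weakly_bounded \<gamma> \<beta>"
  shows "(\<forall>(f :: complex \<Rightarrow> complex) G u.
            open G \<and> connected G \<and> f holomorphic_on G \<and> u \<in> G \<longrightarrow>
            (\<exists>r>0. ball u r \<subseteq> G \<and>
               uniform_limit (ball u r) (\<lambda>N z. \<Sum>k<N. chromatic_term P \<alpha> f u k z) f sequentially)) \<and>
         (\<forall>(f :: complex \<Rightarrow> complex) u.
            f holomorphic_on UNIV \<longrightarrow>
            (\<forall>z. (\<lambda>k. chromatic_term P \<alpha> f u k z) sums f z) \<and>
            (\<forall>r>0. uniform_limit (ball u r)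
                     (\<lambda>N z. \<Sum>k<N. chromatic_term P \<alpha> f u k z) f sequentially))"
proof -
  obtain B p where "B \<ge> 1" "0 \<le> p" "p < 1"
    and "\<And>n. (1 / B) * (real n + 1) powr p \<le> \<gamma> n \<and> \<gamma> n \<le> B * (real n + 1) powr p \<and> \<bar>\<beta> n\<bar> / \<gamma> n \<le> B"
    using assms(4) unfolding weakly_bounded_def by blast
  then interpret weakly_bounded_system \<M> P \<gamma> \<beta> B p
    using assms(1,3) by unfold_locales (auto simp: moment_functional_def)
  have C: "C > 0" using C_ge by simp
  show ?thesis
  proof (intro conjI allI impI)
    fix f :: "complex \<Rightarrow> complex" and G u
    assume G: "open G \<and> connected G \<and> f holomorphic_on G \<and> u \<in> G"
    then obtain R where R: "R > 0" "cball u R \<subseteq> G"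
      using open_contains_cball by blast
    have "ball u (R / (2 * C\<^sup>2)) \<subseteq> G"
      using R shrunk_radius_le[of R] by force
    moreover have "f holomorphic_on cball u R"
      using G R holomorphic_on_subset by blast
    ultimately show "\<exists>r>0. ball u r \<subseteq> G \<and>
        uniform_limit (ball u r) (\<lambda>N z. \<Sum>k<N. chromatic_term P \<alpha> f u k z) f sequentially"
      using chromatic_expansion_near_centre[OF assms(2) R(1)] R(1) C
      by (intro exI[of _ "R / (2 * C\<^sup>2)"]) auto
  next
    fix f :: "complex \<Rightarrow> complex" and u :: complex and r :: real
    assume f: "f holomorphic_on UNIV" and r: "r > 0"
    define R where "R = 2 * C\<^sup>2 * r"
    have "R > 0" "R / (2 * C\<^sup>2) = r"
      using r C by (simp_all add: R_def)
    then show unif: "uniform_limit (ball u r) (\<lambda>N z. \<Sum>k<N. chromatic_term P \<alpha> f u k z) f sequentially"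
      using chromatic_expansion_near_centre[OF assms(2) \<open>R > 0\<close> holomorphic_on_subset[OF f]] by simp
  next
    fix f :: "complex \<Rightarrow> complex" and u z :: complex
    assume f: "f holomorphic_on UNIV"
    define R where "R = 2 * C\<^sup>2 * (dist u z + 1)"
    have "R > 0" "R / (2 * C\<^sup>2) = dist u z + 1"
      using C by (simp_all add: R_def add_nonneg_pos)
    then have "uniform_limit (ball u (dist u z + 1)) (\<lambda>N z. \<Sum>k<N. chromatic_term P \<alpha> f u k z) f sequentially"
      using chromatic_expansion_near_centre[OF assms(2) \<open>R > 0\<close> holomorphic_on_subset[OF f]] by simp
    then show "(\<lambda>k. chromatic_term P \<alpha> f u k z) sums f z"
      unfolding sums_def by (rule tendsto_uniform_limitI) simp
  qed
qed

end
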